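(* Let $K \ge 1$, let $(\mathcal{X}_k, d_k)$, $k = 1, \dots, K$, be metric spaces, let $\mathcal{X} = \mathcal{X}_1 \times \dots \times \mathcal{X}_K$, let $L_1, \dots, L_K \ge 0$, and let $V \subseteq \mathcal{X}$, $\mathcal{O} \subseteq \mathcal{X}$ and a $d_L$-short function $G \colon \mathcal{X} \to \mathbb{R}$ be given. Fix $z_0 \in \mathcal{O} \setminus V$. Suppose that $p \in \mathcal{X}$ is between $V$ and $z_0$, and that there exist $z', z'' \in \mathcal{O} \cap V$ satisfying $$G(z') + d_L(z', p) \le G(z_0) + d_L(z_0, p),$$ $$G(z'') - d_L(z'', p) \ge G(z_0) - d_L(z_0, p).$$ Then $z_0$ is redundant on $V$ with respect to $\mathcal{O} \cap V$.
   Context: Points of $\mathcal{X}$ are written $x = (x^1, \dots, x^K)$. Define $d_L(x, x') := \sum_{k=1}^K L_k d_k(x^k, x'^k)$. A function $f \colon \mathcal{X} \to \mathbb{R}$ is $d_L$-short if $|f(x) - f(x')| \le d_L(x, x')$ for all $x, x' \in \mathcal{X}$. A point $p \in \mathcal{X}$ is between $V \subseteq \mathcal{X}$ and a point $z_0 \in \mathcal{X}$ if $d_L(x, z_0) = d_L(x, p) + d_L(p, z_0)$ for every $x \in V$. For $V, \mathcal{O}' \subseteq \mathcal{X}$, an observation point $z_0$ (with observed value $G(z_0)$) is redundant on $V$ with respect to $\mathcal{O}'$ if, for all $(x, y) \in V \times \mathbb{R}$: whenever $|y - G(z)| \le d_L(x, z)$ for all $z \in \mathcal{O}'$, then also $|y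 - G(z_0)| \le d_L(x, z_0)$. *)

theory Defs
  imports "HOL-Analysis.Abstract_Metric_Spaces"
begin

text \<open>
  The spaces \<open>(X k, d k)\<close>, \<open>k \<in> {1..K}\<close>, are carrier-based metric spaces (locale
  \<^locale>\<open>Metric_space\<close>) inside one arbitrary ambient type; heterogeneous factors are covered by
  embedding them into a common type, e.g. their disjoint union. Points of the product are the
  extensional functions in \<open>PiE {1..K} X\<close>.
\<close>

abbreviation product_space :: "nat \<Rightarrow> (nat \<Rightarrow> 'a set) \<Rightarrow> (nat \<Rightarrow> 'a) set" where
  "product_space K X \<equiv> PiE {1..K} X"

definition dL :: "nat \<Rightarrow> (nat \<Rightarrow> real) \<Rightarrow> (nat \<Rightarrow> 'a \<Rightarrow> 'a \<Rightarrow> real) \<Rightarrow> (nat \<Rightarrow> 'a) \<Rightarrow> (nat \<Rightarrow> 'a) \<Rightarrow> real" where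
  "dL K L d x x' = (\<Sum>k=1..K. L k * d k (x k) (x' k))"

text \<open>The remaining notions take the distance as the parameter \<open>\<rho>\<close>, to be used with \<open>\<rho> = dL K L d\<close>.
  As the weights \<open>L k\<close> may vanish, \<open>\<rho>\<close> is in general only a pseudometric.\<close>

definition short_on :: "'p set \<Rightarrow> ('p \<Rightarrow> 'p \<Rightarrow> real) \<Rightarrow> ('p \<Rightarrow> real) \<Rightarrow> bool" where
  "short_on S \<rho> f \<longleftrightarrow> (\<forall>x\<in>S. \<forall>x'\<in>S. \<bar>f x - f x'\<bar> \<le> \<rho> x x')"

definition is_between :: "('p \<Rightarrow> 'p \<Rightarrow> real) \<Rightarrow> 'p \<Rightarrow> 'p set \<Rightarrow> 'p \<Rightarrow> bool" where
  "is_between \<rho> p V z0 \<longleftrightarrow> (\<forall>x\<in>V. \<rho> x z0 = \<rho> x p + \<rho> p z0)"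

definition redundant_on ::
  "('p \<Rightarrow> 'p \<Rightarrow> real) \<Rightarrow> ('p \<Rightarrow> real) \<Rightarrow> 'p \<Rightarrow> 'p set \<Rightarrow> 'p set \<Rightarrow> bool" where
  "redundant_on \<rho> G z0 V Obs' \<longleftrightarrow>
     (\<forall>(x, y) \<in> V \<times> (UNIV :: real set).
        (\<forall>z\<in>Obs'. \<bar>y - G z\<bar> \<le> \<rho> x z) \<longrightarrow> \<bar>y - G z0\<bar> \<le> \<rho> x z0)"

end

(* An admissible value y at x is at most G z' + dL x z'. Routing the triangle inequality through p,
   this is at most dL x p + (G z' + dL z' p), hence at most dL x p + (G z0 + dL z0 p), which
   betweenness turns into G z0 + dL x z0. The lower bound is the mirror image, with z''. *)
theory Submission imports Defs begin

lemma dL_commute: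
  assumes "\<And>k. k \<in> {1..K} \<Longrightarrow> Metric_space (X k) (d k)"
  shows "dL K L d x y = dL K L d y x"
  unfolding dL_def by (intro sum.cong refl) (metis assms Metric_space.commute)

text \<open>The triangle inequality of each factor survives scaling by a nonnegative weight and
  summation. Vanishing weights do no harm, so a pseudometric suffices.\<close>

lemma dL_triangle:
  assumes "\<And>k. k \<in> {1..K} \<Longrightarrow> Metric_space (X k) (d k)"
    and "\<And>k. k \<in> {1..K} \<Longrightarrow> L k \<ge> 0"
    and "x \<in> product_space K X" "y \<in> product_space K X" "z \<in> product_space K X"
  shows "dL K L d x z \<le> dL K L d x y + dL K L d y z"
  \<comment> \<open>Merging the right-hand side into one sum of terms \<open>L k * (_ + _)\<close>
    lets the two sides be compared factor by factor.\<close>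
  unfolding dL_def sum.distrib[symmetric] distrib_left[symmetric]
proof (intro sum_mono mult_left_mono)
  fix k assume k: "k \<in> {1..K}"
  show "d k (x k) (z k) \<le> d k (x k) (y k) + d k (y k) (z k)"
    using k assms(3-5) by (intro Metric_space.triangle[OF assms(1)[OF k]]) auto
  show "0 \<le> L k" using assms(2) k by blast
qed

theorem theorem5p3:
  fixes K :: nat
    and X :: "nat \<Rightarrow> 'a set"
    and d :: "nat \<Rightarrow> 'a \<Rightarrow> 'a \<Rightarrow> real"
    and L :: "nat \<Rightarrow> real"
    and V Obs :: "(nat \<Rightarrow> 'a) set"
    and G :: "(nat \<Rightarrow> 'a) \<Rightarrow> real"
    and z0 p :: "nat \<Rightarrow> 'a"
  assumes "K \<ge> 1"
    and "\<And>k. k \<in> {1..K} \<Longrightarrow> Metric_space (X k) (d k)"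
    and "\<And>k. k \<in> {1..K} \<Longrightarrow> L k \<ge> 0"
    and "V \<subseteq> product_space K X"
    and "Obs \<subseteq> product_space K X"
    and "short_on (product_space K X) (dL K L d) G"
    and "z0 \<in> Obs - V"
    and "p \<in> product_space K X"
    and "is_between (dL K L d) p V z0"
    and "\<exists>z' z''. z' \<in> Obs \<inter> V \<and> z'' \<in> Obs \<inter> V \<and>
           G z' + dL K L d z' p \<le> G z0 + dL K L d z0 p \<and>
           G z'' - dL K L d z'' p \<ge> G z0 - dL K L d z0 p"
  shows "redundant_on (dL K L d) G z0 V (Obs \<inter> V)"
proof -
  obtain z' z'' where z: "z' \<in> Obs \<inter> V" "z'' \<in> Obs \<inter> V"
    and upper: "G z' + dL K L d z' p \<le> G z0 + dL K L d z0 p"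
    and lower: "G z'' - dL K L d z'' p \<ge> G z0 - dL K L d z0 p"
    using assms(10) by blast
  have comm: "dL K L d a b = dL K L d b a" for a b
    using assms(2) by (rule dL_commute)
  \<comment> \<open>The second leg is written \<open>dL K L d w p\<close>, the orientation in which
    \<open>upper\<close> and \<open>lower\<close> measure distances to \<open>p\<close>.\<close>
  have via_p: "dL K L d x w \<le> dL K L d x p + dL K L d w p" if "x \<in> V" "w \<in> V" for x w
  proof -
    have "dL K L d x w \<le> dL K L d x p + dL K L d p w"
      using that assms(4,8) by (intro dL_triangle[OF assms(2,3)]) auto
    then show ?thesis
      by (simp only: comm[of p w])
  qed
  have "\<bar>y - G z0\<bar> \<le> dL K L d x z0"
    if "x \<in> V" and adm: "\<forall>w\<in>Obs \<inter> V. \<bar>y - G w\<bar> \<le> dL K L d x w" for x y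
  proof -
    \<comment> \<open>Since betweenness is an equality, the leg from \<open>x\<close> to
      \<open>p\<close> cancels exactly when this is compared with the bounds routed through
      \<open>p\<close>.\<close>
    have "dL K L d x z0 = dL K L d x p + dL K L d z0 p"
      using assms(9) \<open>x \<in> V\<close> comm[of p z0] by (simp add: is_between_def)
    moreover have "\<bar>y - G w\<bar> \<le> dL K L d x p + dL K L d w p" if "w \<in> Obs \<inter> V" for w
      using adm that via_p[of x w] \<open>x \<in> V\<close> by (meson IntD2 order_trans)
    \<comment> \<open>The instances at \<open>z'\<close> and \<open>z''\<close> replace the general
      bound, leaving linear arithmetic: \<open>z'\<close> with \<open>upper\<close> caps
      \<open>y\<close>, \<open>z''\<close> with \<open>lower\<close> bounds it below.\<close>
    note this[OF z(1)] this[OF z(2)]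
    ultimately show ?thesis
      using upper lower by linarith
  qed
  then show ?thesis
    by (auto simp: redundant_on_def)
qed

end
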